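(* For every integer $n\ge 1$ and every $x\in\mathbb{R}$, the $n$th derivative of the inverse tangent function satisfies \[ \arctan^{(n)}(x) = (n-1)!\,\frac{q_{n-1}(x)}{(1+x^2)^n}. \]
   Context: For each integer $n\ge 0$, the polynomial $q_n:\mathbb{R}\to\mathbb{R}$ is defined by \[ q_n(x) = (-1)^n \sum_{k\ \text{even},\ 0\le k\le n} \binom{n+1}{k+1} (-1)^{k/2} x^{n-k}. \] Here $x^0=1$ for all $x$, and $\arctan^{(n)}$ denotes the $n$th derivative of $\arctan:\mathbb{R}\to(-\pi/2,\pi/2)$. *)

theory Defs
  imports "HOL-Analysis.Analysis"
begin

definition q_poly :: "nat \<Rightarrow> real \<Rightarrow> real" where
  "q_poly n x = (-1) ^ n *
     (\<Sum>k | even k \<and> k \<le> n. real ((n + 1) choose (k + 1)) * (-1) ^ (k div 2) * x ^ (n - k))"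

end

theory Submission
  imports Defs
begin

text \<open>
  By the binomial theorem, $q_n(x) = (-1)^n\,\mathrm{Im}\,(x + i)^{n+1}$. Since
  $(x + i)(x - i) = 1 + x^2$, the claim becomes
  $\arctan^{(n)}(x) = (-1)^{n-1} (n-1)!\,\mathrm{Im}\,(x - i)^{-n}$, which is obtained by
  differentiating $\arctan'(x) = \mathrm{Im}\,(x - i)^{-1}$ repeatedly.
\<close>

lemma Im_i_power_Suc:
  "Im (\<i> ^ Suc k) = (if even k then (-1) ^ (k div 2) else 0)"
proof (cases "even k")
  case True
  then obtain m where "k = 2 * m" by blast
  then show ?thesis by (simp add: power_mult flip: of_real_minus of_real_power)
next
  case False
  then obtain m where "k = 2 * m + 1" by (rule oddE)
  then show ?thesis by (simp add: power_mult flip: of_real_minus of_real_power)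
qed

lemma q_poly_eq_Im: "q_poly n x = (-1) ^ n * Im ((of_real x + \<i>) ^ Suc n)"
proof -
  have "(of_real x + \<i>) ^ Suc n
      = (\<Sum>j\<le>Suc n. \<i> ^ j * of_real (real (Suc n choose j) * x ^ (Suc n - j)))"
    by (subst add.commute, subst binomial_ring) (simp add: mult_ac)
  then have "Im ((of_real x + \<i>) ^ Suc n)
      = (\<Sum>j\<le>Suc n. Im (\<i> ^ j) * (real (Suc n choose j) * x ^ (Suc n - j)))"
    by (simp del: sum.atMost_Suc of_real_mult of_real_power power_Suc)
  \<comment> \<open>The term \<open>j = 0\<close> drops out because \<open>Im 1 = 0\<close>; the
    shift \<open>j = Suc k\<close> produces the binomials \<open>(n + 1) choose (k + 1)\<close> of
    \<open>q_poly\<close>. The terms with odd \<open>k\<close> then vanish, since an even power of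
    \<open>\<i>\<close> is real.\<close>
  also have "\<dots> = (\<Sum>k\<le>n. Im (\<i> ^ Suc k) * (real (Suc n choose Suc k) * x ^ (n - k)))"
    by (subst sum.atMost_Suc_shift) (simp del: power_Suc binomial_Suc_Suc)
  also have "\<dots> = (\<Sum>k\<le>n. if even k
      then real ((n + 1) choose (k + 1)) * (-1) ^ (k div 2) * x ^ (n - k) else 0)"
    by (intro sum.cong refl) (simp add: Im_i_power_Suc del: power_Suc binomial_Suc_Suc)
  also have "\<dots> = (\<Sum>k | even k \<and> k \<le> n.
      real ((n + 1) choose (k + 1)) * (-1) ^ (k div 2) * x ^ (n - k))"
    by (subst sum.inter_filter [symmetric]) (auto intro!: sum.cong)
  finally show ?thesis by (simp add: q_poly_def)
qed

lemma of_real_diff_i_nonzero: "of_real x - \<i> \<noteq> 0"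
  by (simp add: complex_eq_iff)

text \<open>Conjugate factors multiply to \<open>1 + x\<^sup>2\<close>. With a real denominator,
  \<open>Im\<close> can be taken in the numerator alone.\<close>

lemma inverse_of_real_diff_i:
  "inverse (of_real x - \<i>) = (of_real x + \<i>) / of_real (1 + x\<^sup>2)"
proof -
  have "(of_real x - \<i>) * (of_real x + \<i>) = of_real (1 + x\<^sup>2)"
    by (simp add: algebra_simps power2_eq_square)
  moreover have "of_real (1 + x\<^sup>2) \<noteq> (0 :: complex)"
    using sum_power2_gt_zero_iff[of 1 x] by (simp only: of_real_eq_0_iff) simp
  ultimately show ?thesis
    using of_real_diff_i_nonzero[of x] by (simp add: field_simps del: of_real_add of_real_power)
qed

lemma q_poly_over_power:
  "q_poly n x / (1 + x\<^sup>2) ^ Suc n = (-1) ^ n * Im (inverse (of_real x - \<i>) ^ Suc n)"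
  unfolding q_poly_eq_Im inverse_of_real_diff_i power_divide
  by (simp only: Im_divide_of_real of_real_power [symmetric] times_divide_eq_right)

text \<open>The power rule for the complex function \<open>inverse (z - \<i>) ^ n\<close> is
  restricted to the real line, and the bounded linear map \<open>Im\<close> commutes with
  differentiation.\<close>

lemma has_real_derivative_Im_inverse_power:
  "((\<lambda>x. Im (inverse (of_real x - \<i>) ^ n)) has_real_derivative
     - real n * Im (inverse (of_real x - \<i>) ^ Suc n)) (at x)"
proof -
  have "((\<lambda>z. inverse (z - \<i>) ^ n) has_field_derivative
      - of_nat n * inverse (of_real x - \<i>) ^ Suc n) (at (of_real x))"
  \<comment> \<open>\<open>DERIV_power_Suc\<close> covers positive exponents; for
    \<open>n = 0\<close> the function is constant and the factor \<open>of_nat n\<close> is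
    zero.\<close>
  proof (cases n)
    case (Suc k)
    have "((\<lambda>z. inverse (z - \<i>)) has_field_derivative - (inverse (of_real x - \<i>) ^ 2))
        (at (of_real x))"
      using of_real_diff_i_nonzero[of x]
      by (auto intro!: derivative_eq_intros simp: power2_eq_square)
    from DERIV_power_Suc[OF this, of k] show ?thesis
      by (simp add: Suc power2_eq_square algebra_simps)
  qed simp
  then have "((\<lambda>x. inverse (of_real x - \<i>) ^ n) has_vector_derivative
      - of_nat n * inverse (of_real x - \<i>) ^ Suc n) (at x)"
    by (rule has_vector_derivative_real_field)
  then have "((\<lambda>x. Im (inverse (of_real x - \<i>) ^ n)) has_vector_derivative
      Im (- of_nat n * inverse (of_real x - \<i>) ^ Suc n)) (at x)"
    by (rule bounded_linear.has_vector_derivative[OF bounded_linear_Im])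
  then show ?thesis
    by (simp add: has_real_derivative_iff_has_vector_derivative del: power_Suc)
qed

text \<open>An equality of functions rather than of values at a point, so that the induction
  hypothesis can be rewritten under \<open>deriv\<close>.\<close>

lemma higher_deriv_arctan:
  "(deriv ^^ Suc m) arctan
    = (\<lambda>x. (-1) ^ m * fact m * Im (inverse (of_real x - \<i>) ^ Suc m))"
proof (induction m)
  case 0
  have "deriv arctan x = Im (inverse (of_real x - \<i>))" for x
    using DERIV_imp_deriv[OF DERIV_arctan[of x]]
    by (simp only: inverse_of_real_diff_i Im_divide_of_real) (simp add: field_simps)
  then show ?case by auto
next
  case (Suc m)
  have "deriv (\<lambda>x. (-1) ^ m * fact m * Im (inverse (of_real x - \<i>) ^ Suc m)) x
      = (-1) ^ m * fact m * (- real (Suc m) * Im (inverse (of_real x - \<i>) ^ Suc (Suc m)))" for x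
    by (intro DERIV_imp_deriv DERIV_cmult has_real_derivative_Im_inverse_power)
  \<comment> \<open>The new factor \<open>- real (Suc m)\<close> flips the sign and extends the
    factorial.\<close>
  also have "(-1) ^ m * fact m * (- real (Suc m) * Im (inverse (of_real x - \<i>) ^ Suc (Suc m)))
       = (-1) ^ Suc m * fact (Suc m) * Im (inverse (of_real x - \<i>) ^ Suc (Suc m))" for x
    by (simp only: fact_Suc power_Suc[of "-1"]) (simp add: algebra_simps del: power_Suc)
  finally show ?case
    unfolding funpow.simps(2)[of "Suc m"] comp_apply Suc.IH by (rule ext)
qed

theorem theorem3p1:
  fixes n :: nat and x :: real
  assumes "n \<ge> 1"
  shows "(deriv ^^ n) arctan x = fact (n - 1) * (q_poly (n - 1) x / (1 + x\<^sup>2) ^ n)"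
proof -
  obtain m where n: "n = Suc m"
    using assms by (cases n) auto
  show ?thesis
    unfolding n higher_deriv_arctan diff_Suc_1 q_poly_over_power by (simp only: mult_ac)
qed

end
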